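(* Let $m,n\in\mathbb{N}$ and let $A,B\in\mathbb{N}$ be such that $A\mid B$ and $AB\mid mn$. Let $N_{A,B}(m,n)$ denote the number of subgroups of $\mathbb{Z}_m\times\mathbb{Z}_n$ which are isomorphic to $\mathbb{Z}_A\times\mathbb{Z}_B$. If $A\mid\gcd(m,n)$, then $$N_{A,B}(m,n)=\sum_{\substack{i\mid m,\ j\mid n\\ AB\mid ij\\ \operatorname{lcm}(i,j)=B}}\phi\left(\frac{ij}{AB}\right).$$ If $A\nmid\gcd(m,n)$, then $N_{A,B}(m,n)=0$.
   Context: $\mathbb{N}=\{1,2,\ldots\}$. $\mathbb{Z}_m$ denotes the additive group of residue classes modulo $m$. $\phi$ is Euler's totient function. The sum runs over pairs $(i,j)$ of positive integers satisfying the listed conditions; an empty sum is $0$. *)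

theory Defs
  imports "HOL-Algebra.Algebra" "HOL-Number_Theory.Totient"
begin

text \<open>Subgroups are counted as subsets of the product group, not up to isomorphism.
  Beware that the library group \<open>integer_mod_group 0\<close> is the infinite cyclic
  group, so the count is only meaningful for positive arguments.\<close>

definition num_subgroups_iso :: "nat \<Rightarrow> nat \<Rightarrow> nat \<Rightarrow> nat \<Rightarrow> nat" where
  "num_subgroups_iso A B m n =
     card {H. subgroup H (integer_mod_group m \<times>\<times> integer_mod_group n) \<and>
              (integer_mod_group m \<times>\<times> integer_mod_group n)\<lparr>carrier := H\<rparr>
                \<cong> integer_mod_group A \<times>\<times> integer_mod_group B}"

end

theory Submission
  imports Defs
begin

text \<open>
  By Goursat's lemma a subgroup of \<open>\<int>\<^sub>m \<times> \<int>\<^sub>n\<close> is the same thing as a choice of the orders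
  \<open>i\<close> dividing \<open>m\<close> and \<open>j\<close> dividing \<open>n\<close> of its two projections, a common divisor \<open>e\<close>
  of \<open>i\<close> and \<open>j\<close>, and a unit \<open>u\<close> modulo \<open>e\<close>: it consists of the pairs
  \<open>(m/i * x, n/j * y)\<close> with \<open>y\<close> congruent to \<open>u * x\<close> modulo \<open>e\<close>.
  Such a subgroup is isomorphic to \<open>\<int>\<^sub>A \<times> \<int>\<^sub>B\<close> with \<open>A = gcd i j / e\<close> and \<open>B = lcm i j\<close>.
  Order and exponent determine \<open>A\<close> and \<open>B\<close>, so \<open>e = i j / (A B)\<close> and each admissible pair
  \<open>(i, j)\<close> contributes one subgroup for every unit modulo \<open>e\<close>. Subgroups of the finite
  group are handled through their preimages in \<open>\<int> \<times> \<int>\<close>, where no reduction is needed.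
\<close>

section \<open>Subgroups of \<int> \<times> \<int> and their Goursat normal form\<close>

definition int_submodule :: "(int \<times> int) set \<Rightarrow> bool" where
  "int_submodule L \<longleftrightarrow> (0, 0) \<in> L \<and>
     (\<forall>x y x' y'. (x, y) \<in> L \<longrightarrow> (x', y') \<in> L \<longrightarrow> (x - x', y - y') \<in> L)"

lemma int_submodule_diff:
  "int_submodule L \<Longrightarrow> (x, y) \<in> L \<Longrightarrow> (x', y') \<in> L \<Longrightarrow> (x - x', y - y') \<in> L"
  unfolding int_submodule_def by blast

lemma int_submodule_add:
  assumes "int_submodule L" "(x, y) \<in> L" "(x', y') \<in> L"
  shows "(x + x', y + y') \<in> L"
proof -
  have "(0 - x', 0 - y') \<in> L"
    using assms int_submodule_diff unfolding int_submodule_def by blast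
  from int_submodule_diff[OF assms(1,2) this] show ?thesis by simp
qed

lemma int_submodule_scale:
  assumes L: "int_submodule L" and "(x, y) \<in> L"
  shows "(k * x, k * y) \<in> L"
proof (induction k rule: int_induct[of _ 0])
  case base
  then show ?case using L by (simp add: int_submodule_def)
next
  case (step1 i)
  from int_submodule_add[OF L step1(2) assms(2)] show ?case by (simp add: algebra_simps)
next
  case (step2 i)
  from int_submodule_diff[OF L step2(2) assms(2)] show ?case by (simp add: algebra_simps)
qed

text \<open>Reduction changes \<open>(x, y)\<close> by \<open>(x div m * m, y div n * n)\<close>, a
  vector of \<open>L\<close>. Membership in \<open>L\<close> can therefore be tested on canonical
  residues.\<close>

lemma int_submodule_mod_iff:
  assumes L: "int_submodule L" and "(m, 0) \<in> L" "(0, n) \<in> L"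
  shows "(x mod m, y mod n) \<in> L \<longleftrightarrow> (x, y) \<in> L"
proof -
  have "((x div m) * m, (x div m) * 0) \<in> L" "((y div n) * 0, (y div n) * n) \<in> L"
    using assms int_submodule_scale by blast+
  from int_submodule_add[OF L this] have *: "(x div m * m, y div n * n) \<in> L" by simp
  show ?thesis
    using int_submodule_add[OF L _ *, of "x mod m" "y mod n"]
      int_submodule_diff[OF L _ *, of x y]
    by (auto simp: minus_div_mult_eq_mod)
qed

text \<open>Division with remainder by the least positive element of \<open>S\<close>; the positive
  member \<open>n\<close> ensures that such an element exists.\<close>

lemma int_subgroup_eq_multiples:
  fixes S :: "int set"
  assumes "0 \<in> S" and diff: "\<And>x y. x \<in> S \<Longrightarrow> y \<in> S \<Longrightarrow> x - y \<in> S" and "n \<in> S" "n > 0"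
  shows "\<exists>d>0. S = {x. d dvd x}"
proof -
  define d where "d = (LEAST k::nat. k > 0 \<and> int k \<in> S)"
  have "nat n > 0 \<and> int (nat n) \<in> S" using assms by simp
  hence d: "d > 0" "int d \<in> S" unfolding d_def by (metis (mono_tags, lifting) LeastI)+
  have least: "k \<ge> d" if "k > 0" "int k \<in> S" for k
    unfolding d_def using that by (simp add: Least_le)
  have mult: "k * int d \<in> S" for k
  proof -
    have neg: "- x \<in> S" if "x \<in> S" for x using diff[OF \<open>0 \<in> S\<close> that] by simp
    have add: "x + y \<in> S" if "x \<in> S" "y \<in> S" for x y
      using diff[OF that(1) neg[OF that(2)]] by simp
    show ?thesis
    proof (induction k rule: int_induct[of _ 0])
      case (step1 i) from add[OF this(2) d(2)] show ?case by (simp add: algebra_simps)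
    next
      case (step2 i) from diff[OF this(2) d(2)] show ?case by (simp add: algebra_simps)
    qed (simp add: \<open>0 \<in> S\<close>)
  qed
  have "int d dvd x" if "x \<in> S" for x
  proof -
    have "x mod int d \<in> S"
      using diff[OF that mult[of "x div int d"]] by (simp add: minus_div_mult_eq_mod)
    moreover have "x mod int d < int d" "x mod int d \<ge> 0" using d by simp_all
    ultimately have "x mod int d = 0"
      using least[of "nat (x mod int d)"] by (cases "x mod int d = 0") auto
    thus ?thesis by presburger
  qed
  moreover have "x \<in> S" if "int d dvd x" for x
    using that mult by (metis dvdE mult.commute)
  ultimately show ?thesis using d by (intro exI[of _ "int d"]) auto
qed

text \<open>A fibre product: after division by \<open>a\<close> and \<open>b\<close> the coordinates
  are linked modulo \<open>e\<close> through multiplication by \<open>u\<close>. For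
  \<open>u\<close> coprime to \<open>e\<close> the two projections are exactly the multiples of
  \<open>a\<close> and of \<open>b\<close>.\<close>

definition goursat_lattice :: "int \<Rightarrow> int \<Rightarrow> int \<Rightarrow> int \<Rightarrow> (int \<times> int) set" where
  "goursat_lattice a b e u = {(a * x, b * y) | x y. e dvd y - u * x}"

lemma goursat_lattice_iff:
  assumes "a \<noteq> 0" "b \<noteq> 0"
  shows "(a * x, b * y) \<in> goursat_lattice a b e u \<longleftrightarrow> e dvd y - u * x"
  using assms by (auto simp: goursat_lattice_def)

lemma goursat_latticeE:
  assumes "z \<in> goursat_lattice a b e u"
  obtains x y where "z = (a * x, b * y)" "e dvd y - u * x"
  using assms unfolding goursat_lattice_def by blast

lemma int_submodule_goursat_lattice:
  assumes "a \<noteq> 0" "b \<noteq> 0"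
  shows "int_submodule (goursat_lattice a b e u)"
  unfolding int_submodule_def
proof (intro conjI allI impI)
  note iff = goursat_lattice_iff[OF assms]
  show "(0, 0) \<in> goursat_lattice a b e u" using iff[of 0 0] by simp
  fix x y x' y'
  assume "(x, y) \<in> goursat_lattice a b e u" "(x', y') \<in> goursat_lattice a b e u"
  then obtain p q p' q' where *: "(x, y) = (a * p, b * q)" "(x', y') = (a * p', b * q')"
    and dvd: "e dvd q - u * p" "e dvd q' - u * p'"
    by (elim goursat_latticeE)
  from dvd_diff[OF dvd] have "e dvd (q - q') - u * (p - p')" by (simp add: algebra_simps)
  from this[folded iff] show "(x - x', y - y') \<in> goursat_lattice a b e u"
    using * by (simp add: right_diff_distrib)
qed

lemma goursat_lattice_cong:
  assumes "[u = v] (mod e)"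
  shows "goursat_lattice a b e u = goursat_lattice a b e v"
proof -
  have "e dvd y - u * x \<longleftrightarrow> e dvd y - v * x" for x y
  proof -
    have "[y - u * x = y - v * x] (mod e)"
      using assms by (intro cong_diff cong_mult) auto
    thus ?thesis by (simp add: cong_dvd_iff)
  qed
  thus ?thesis by (simp add: goursat_lattice_def)
qed

text \<open>Take \<open>a\<close> and \<open>b\<close> as generators of the two projections and
  \<open>c = b * e\<close> as generator of the fibre over 0. One vector \<open>(a, b * u)\<close>
  above \<open>a\<close> then determines the rest of \<open>L\<close>.\<close>

lemma int_submodule_eq_goursat_lattice:
  assumes L: "int_submodule L" and m: "(m, 0) \<in> L" "m > 0" and n: "(0, n) \<in> L" "n > 0"
  obtains a b e u where "a > 0" "b > 0" "e > 0" "coprime u e" "a * e dvd m" "b * e dvd n"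
    "L = goursat_lattice a b e u"
proof -
  note diff = int_submodule_diff[OF L] and add = int_submodule_add[OF L]
    and scale = int_submodule_scale[OF L]
  have zero: "(0, 0) \<in> L" using L by (simp add: int_submodule_def)
  have "\<exists>a>0. {x. \<exists>y. (x, y) \<in> L} = {x. a dvd x}"
  proof (rule int_subgroup_eq_multiples)
    fix x y assume "x \<in> {x. \<exists>y. (x, y) \<in> L}" "y \<in> {x. \<exists>y. (x, y) \<in> L}"
    thus "x - y \<in> {x. \<exists>y. (x, y) \<in> L}" using diff by blast
  qed (use zero m in auto)
  then obtain a where a: "a > 0" "\<And>x. (\<exists>y. (x, y) \<in> L) \<longleftrightarrow> a dvd x"
    by (auto simp: set_eq_iff)
  have "\<exists>b>0. {y. \<exists>x. (x, y) \<in> L} = {y. b dvd y}"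
  proof (rule int_subgroup_eq_multiples)
    fix x y assume "x \<in> {y. \<exists>x. (x, y) \<in> L}" "y \<in> {y. \<exists>x. (x, y) \<in> L}"
    thus "x - y \<in> {y. \<exists>x. (x, y) \<in> L}" using diff by blast
  qed (use zero n in auto)
  then obtain b where b: "b > 0" "\<And>y. (\<exists>x. (x, y) \<in> L) \<longleftrightarrow> b dvd y"
    by (auto simp: set_eq_iff)
  have "\<exists>c>0. {y. (0, y) \<in> L} = {y. c dvd y}"
  proof (rule int_subgroup_eq_multiples)
    fix x y assume "x \<in> {y. (0, y) \<in> L}" "y \<in> {y. (0, y) \<in> L}"
    thus "x - y \<in> {y. (0, y) \<in> L}" using diff[of 0 x 0 y] by simp
  qed (use zero n in auto)
  then obtain c where c: "c > 0" "\<And>y. (0, y) \<in> L \<longleftrightarrow> c dvd y"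
    by (auto simp: set_eq_iff)
  have "b dvd c" using b(2)[of c] c(2)[of c] by auto
  then obtain e where e: "c = b * e" by blast
  have "e > 0" using c(1) b(1) e by (simp add: zero_less_mult_iff)
  obtain y0 where "(a, y0) \<in> L" using a(2)[of a] by auto
  moreover from this obtain u where "y0 = b * u" using b(2)[of y0] by (auto elim: dvdE)
  ultimately have u: "(a, b * u) \<in> L" by simp
  \<comment> \<open>Subtracting \<open>x\<close> times \<open>(a, b * u)\<close> moves the pair into
    the fibre over 0, which is known to consist of the multiples of \<open>b * e\<close>.\<close>
  have iff: "(a * x, b * y) \<in> L \<longleftrightarrow> e dvd y - u * x" for x y
  proof -
    have "(a * x, b * y) \<in> L \<longleftrightarrow> (0, b * (y - u * x)) \<in> L"
      using diff[of "a * x" "b * y" "x * a" "x * (b * u)"] scale[OF u, of x]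
        add[of 0 "b * (y - u * x)" "x * a" "x * (b * u)"]
      by (auto simp: algebra_simps)
    also have "\<dots> \<longleftrightarrow> e dvd y - u * x"
      using c(2) b(1) e by simp
    finally show ?thesis .
  qed
  have L_eq: "L = goursat_lattice a b e u"
  proof (intro equalityI subsetI)
    fix z assume z: "z \<in> L"
    obtain x y where xy: "z = (x, y)" by fastforce
    then have "a dvd x" "b dvd y" using z a(2)[of x] b(2)[of y] by auto
    then obtain p q where "x = a * p" "y = b * q" by blast
    thus "z \<in> goursat_lattice a b e u" using iff xy z unfolding goursat_lattice_def by blast
  next
    fix z assume "z \<in> goursat_lattice a b e u"
    thus "z \<in> L" using iff unfolding goursat_lattice_def by blast
  qed
  \<comment> \<open>Some vector of \<open>L\<close> has second coordinate \<open>b\<close>; its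
    first coordinate \<open>a * v\<close> supplies an inverse \<open>v\<close> of \<open>u\<close>
    modulo \<open>e\<close>.\<close>
  have "coprime u e"
  proof -
    obtain x0 where "(x0, b) \<in> L" using b(2)[of b] by auto
    moreover from this obtain v where "x0 = a * v" using a(2)[of x0] by (auto elim: dvdE)
    ultimately have "e dvd 1 - u * v" using iff[of v 1] by simp
    then obtain k where "1 - u * v = e * k" by blast
    hence "u * v + e * k = 1" by simp
    show ?thesis
    proof (rule coprimeI)
      fix d assume "d dvd u" "d dvd e"
      thus "is_unit d" by (subst \<open>u * v + e * k = 1\<close>[symmetric]) simp
    qed
  qed
  moreover have "b * e dvd n" using c(2)[of n] n e by simp
  moreover have "a * e dvd m"
  proof -
    have "a dvd m" using a(2)[of m] m by auto
    then obtain i where i: "m = a * i" by blast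
    have "e dvd 0 - u * i" using iff[of i 0] m i by simp
    hence "e dvd i" using \<open>coprime u e\<close>
      by (simp add: coprime_commute coprime_dvd_mult_right_iff)
    thus ?thesis using i by simp
  qed
  ultimately show thesis using that a(1) b(1) \<open>e > 0\<close> L_eq by blast
qed

section \<open>Subgroups of the finite group as reductions of lattices\<close>

text \<open>For positive \<open>m\<close> and \<open>n\<close> the box is the carrier of the finite
  product group. If \<open>L\<close> is a subgroup containing \<open>(m, 0)\<close> and
  \<open>(0, n)\<close>, the intersection is the image of \<open>L\<close> under reduction.\<close>

definition residues_of :: "nat \<Rightarrow> nat \<Rightarrow> (int \<times> int) set \<Rightarrow> (int \<times> int) set" where
  "residues_of m n L = L \<inter> {0..<int m} \<times> {0..<int n}"

lemma subgroup_residues_of: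
  assumes "m > 0" "n > 0" and L: "int_submodule L" "(int m, 0) \<in> L" "(0, int n) \<in> L"
  shows "subgroup (residues_of m n L) (integer_mod_group m \<times>\<times> integer_mod_group n)"
proof -
  interpret group "integer_mod_group m \<times>\<times> integer_mod_group n"
    by (simp add: DirProd_group)
  note mod_iff = int_submodule_mod_iff[OF L]
  show ?thesis
  proof (rule subgroupI)
    show "residues_of m n L \<subseteq> carrier (integer_mod_group m \<times>\<times> integer_mod_group n)"
      using assms by (auto simp: residues_of_def carrier_integer_mod_group)
    show "residues_of m n L \<noteq> {}"
      using assms by (auto simp: residues_of_def int_submodule_def intro!: exI[of _ 0])
    fix p assume "p \<in> residues_of m n L"
    then obtain x y where p: "p = (x, y)" "(x, y) \<in> L" "x \<in> {0..<int m}" "y \<in> {0..<int n}"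
      by (auto simp: residues_of_def)
    then have "(- x, - y) \<in> L" using int_submodule_scale[OF L(1), of x y "-1"] by simp
    thus "inv\<^bsub>integer_mod_group m \<times>\<times> integer_mod_group n\<^esub> p \<in> residues_of m n L"
      using p assms mod_iff[of "-x" "-y"]
      by (simp add: carrier_integer_mod_group residues_of_def)
    fix q assume "q \<in> residues_of m n L"
    then obtain x' y' where q: "q = (x', y')" "(x', y') \<in> L"
      by (auto simp: residues_of_def)
    have "(x + x', y + y') \<in> L" using p q int_submodule_add[OF L(1)] by blast
    thus "p \<otimes>\<^bsub>integer_mod_group m \<times>\<times> integer_mod_group n\<^esub> q \<in> residues_of m n L"
      using p q assms mod_iff by (simp add: residues_of_def)
  qed
qed

text \<open>The lattice is the full preimage of \<open>H\<close> under reduction modulo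
  \<open>(m, n)\<close>.\<close>

lemma subgroup_eq_residues_of:
  assumes "m > 0" "n > 0" and H: "subgroup H (integer_mod_group m \<times>\<times> integer_mod_group n)"
  obtains L where "int_submodule L" "(int m, 0) \<in> L" "(0, int n) \<in> L" "H = residues_of m n L"
proof -
  define L where "L = {(x, y). (x mod int m, y mod int n) \<in> H}"
  have H0: "(0, 0) \<in> H" using subgroup.one_closed[OF H] by simp
  have sub: "H \<subseteq> {0..<int m} \<times> {0..<int n}"
    using subgroup.subset[OF H] assms by (simp add: carrier_integer_mod_group)
  have "int_submodule L" unfolding int_submodule_def
  proof (intro conjI allI impI)
    show "(0, 0) \<in> L" using H0 by (simp add: L_def)
    fix x y x' y' assume "(x, y) \<in> L" "(x', y') \<in> L"
    hence a: "(x mod int m, y mod int n) \<in> H" "(x' mod int m, y' mod int n) \<in> H"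
      by (simp_all add: L_def)
    from subgroup.m_inv_closed[OF H a(2)]
    have "((- x') mod int m, (- y') mod int n) \<in> H"
      using assms by (simp add: carrier_integer_mod_group mod_minus_eq)
    from subgroup.m_closed[OF H a(1) this]
    show "(x - x', y - y') \<in> L"
      by (simp add: L_def mod_simps)
  qed
  moreover have "H = residues_of m n L"
    using sub by (auto simp: residues_of_def L_def)
  moreover have "(int m, 0) \<in> L" "(0, int n) \<in> L" using H0 by (simp_all add: L_def)
  ultimately show thesis using that by blast
qed

section \<open>Unit lifts and decomposition into cyclic factors\<close>

text \<open>Add to \<open>u\<close> the product of \<open>e\<close> and all primes of
  \<open>j\<close> that do not divide \<open>u\<close>. A prime of \<open>j\<close> then divides
  exactly one of the two summands: if it divides \<open>u\<close>, it divides neither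
  \<open>e\<close> nor the product.\<close>

lemma ex_coprime_lift:
  fixes u e j :: int
  assumes "coprime u e" "j \<noteq> 0"
  obtains v where "[v = u] (mod e)" "coprime v j"
proof -
  define P where "P = {p. Factorial_Ring.prime p \<and> p dvd j \<and> \<not> p dvd u}"
  have "P \<subseteq> prime_factors j" using assms by (auto simp: P_def in_prime_factors_iff)
  hence fin: "finite P" using finite_subset by blast
  define v where "v = u + e * \<Prod>P"
  have "coprime v j"
  proof (rule ccontr)
    assume "\<not> coprime v j"
    then obtain p where p: "Factorial_Ring.prime p" "p dvd v" "p dvd j"
      using assms(2) prime_divisor_exists[of "gcd v j"] by (auto simp: coprime_iff_gcd_eq_1)
    show False
    proof (cases "p dvd u")
      case True
      with p have "p dvd e * \<Prod>P" unfolding v_def by (simp add: dvd_add_right_iff)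
      moreover have "\<not> p dvd e" using True assms p by (meson coprime_common_divisor not_prime_unit)
      ultimately have "p dvd \<Prod>P" using p by (simp add: prime_dvd_mult_iff)
      then obtain q where "q \<in> P" "p dvd q"
        using p fin prime_dvd_prod_iff[of P p id] by auto
      thus False using p True primes_dvd_imp_eq unfolding P_def by blast
    next
      case False
      hence "p \<in> P" using p by (simp add: P_def)
      hence "p dvd \<Prod>P" using fin dvd_prodI[of P p "\<lambda>x. x"] by simp
      thus False using False p unfolding v_def by (simp add: dvd_add_left_iff)
    qed
  qed
  moreover have "[v = u] (mod e)" by (simp add: v_def cong_def)
  ultimately show thesis using that by blast
qed

text \<open>Bezout writes \<open>y - x\<close> as a multiple of \<open>i\<close> plus a multiple of
  \<open>j\<close>; adding the former to \<open>x\<close> gives \<open>z\<close>.\<close>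

lemma chinese_remainder_gcd_int:
  fixes i j x y :: int
  assumes "[x = y] (mod gcd i j)"
  obtains z where "[z = x] (mod i)" "[z = y] (mod j)"
proof -
  obtain k where k: "y - x = gcd i j * k"
    using assms by (meson cong_iff_dvd_diff cong_sym dvdE)
  obtain r s where "r * i + s * j = gcd i j" using bezout_int by blast
  hence "y - x = (r * i + s * j) * k" using k by simp
  hence "x + r * i * k - y = j * (- (s * k))" by (simp add: algebra_simps)
  hence "[x + r * i * k = y] (mod j)" by (simp add: cong_iff_dvd_diff)
  moreover have "[x + r * i * k = x] (mod i)" by (simp add: cong_iff_dvd_diff)
  ultimately show thesis using that by blast
qed


text \<open>
  The group of pairs \<open>(x, y)\<close> modulo \<open>(i, j)\<close> with \<open>y\<close> congruent to \<open>u * x\<close> modulo \<open>e\<close>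
  is the direct sum of the cyclic groups generated by \<open>(1, v)\<close>, of order \<open>lcm i j\<close>, and
  \<open>(s, v * s + e)\<close>, of order \<open>A\<close>; here \<open>v\<close> is a lift of \<open>u\<close> to a unit modulo \<open>j\<close>.
\<close>
lemma ex_cyclic_decomposition:
  fixes i j e u A :: int
  assumes "i > 0" "j > 0" and A: "A * e = gcd i j" and "coprime u e"
  obtains s v where
    "[v = u] (mod e)"
    "\<forall>q p. i dvd p + q * s \<and> j dvd v * (p + q * s) + q * e \<longleftrightarrow> A dvd q \<and> lcm i j dvd p"
proof -
  obtain v where v: "[v = u] (mod e)" "coprime v j"
    using ex_coprime_lift[of u e j] assms by auto
  obtain w where w: "[v * w = 1] (mod j)" using v cong_solve_coprime_int by blast
  have "[0 = - (w * gcd i j)] (mod gcd i j)" by (simp add: cong_iff_dvd_diff)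
  \<comment> \<open>\<open>t\<close> is to be \<open>A * s\<close>. The two congruences say that
    \<open>A\<close> times the second generator \<open>(s, v * s + e)\<close>, which is
    \<open>(t, v * t + gcd i j)\<close>, vanishes modulo \<open>(i, j)\<close>.\<close>
  then obtain t where t: "[t = 0] (mod i)" "[t = - (w * gcd i j)] (mod j)"
    by (rule chinese_remainder_gcd_int)
  have "i dvd t" using t(1) by (simp add: cong_0_iff)
  have "A dvd gcd i j" using A by (metis dvd_triv_left)
  with \<open>i dvd t\<close> have "A dvd t" by (meson dvd_trans gcd_dvd1)
  then obtain s where s: "t = A * s" by (elim dvdE)
  have "[v * t + gcd i j = v * - (w * gcd i j) + gcd i j] (mod j)"
    by (intro cong_add cong_mult t) auto
  also have "v * - (w * gcd i j) + gcd i j = gcd i j - (v * w) * gcd i j"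
    by (simp add: algebra_simps)
  also have "[gcd i j - (v * w) * gcd i j = gcd i j - 1 * gcd i j] (mod j)"
    by (intro cong_diff cong_mult w) auto
  finally have vt: "j dvd v * t + gcd i j" by (simp add: cong_0_iff)
  have eq: "p + q * s = p + r * t" "v * (p + q * s) + q * e = v * p + r * (v * t + gcd i j)"
    if "q = A * r" for p q r using that s A[symmetric] by (simp_all add: algebra_simps)
  have "i dvd p + q * s \<and> j dvd v * (p + q * s) + q * e \<longleftrightarrow> A dvd q \<and> lcm i j dvd p" for q p
  proof
    assume *: "A dvd q \<and> lcm i j dvd p"
    then obtain r where r: "q = A * r" by (elim conjE dvdE)
    have "i dvd p" "j dvd p" using * by (auto intro: dvd_trans[OF _ conjunct2])
    have "i dvd p + r * t" using \<open>i dvd p\<close> \<open>i dvd t\<close> by simp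
    moreover have "j dvd v * p + r * (v * t + gcd i j)" using \<open>j dvd p\<close> vt by simp
    ultimately show "i dvd p + q * s \<and> j dvd v * (p + q * s) + q * e"
      using eq[OF r] by simp
  next
    assume *: "i dvd p + q * s \<and> j dvd v * (p + q * s) + q * e"
    \<comment> \<open>Modulo \<open>gcd i j\<close> both conditions apply at once, and
      \<open>v\<close> times the first cancels from the second, leaving
      \<open>q * e\<close>.\<close>
    have "gcd i j dvd p + q * s" using * by (meson dvd_trans gcd_dvd1)
    moreover have "gcd i j dvd v * (p + q * s) + q * e" using * by (meson dvd_trans gcd_dvd2)
    ultimately have "gcd i j dvd q * e" by (metis dvd_add_right_iff dvd_mult)
    hence "A * e dvd q * e" using A by simp
    moreover have "e \<noteq> 0" using A assms(1) by auto
    ultimately have "A dvd q" by simp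
    then obtain r where r: "q = A * r" by (elim dvdE)
    have "i dvd p + r * t" "j dvd v * p + r * (v * t + gcd i j)"
      using * eq[OF r] by simp_all
    hence "i dvd p" "j dvd v * p"
      using \<open>i dvd t\<close> vt by (simp_all add: dvd_add_left_iff)
    \<comment> \<open>Here \<open>v\<close> has to be a unit modulo \<open>j\<close>, not only
      modulo \<open>e\<close>.\<close>
    moreover from this v(2) have "j dvd p"
      by (simp add: coprime_commute coprime_dvd_mult_right_iff)
    ultimately show "A dvd q \<and> lcm i j dvd p" using \<open>A dvd q\<close> by simp
  qed
  with v show thesis using that by blast
qed

text \<open>The isomorphism sends \<open>(q, p)\<close> to \<open>q * (s, s') + p * (t, t')\<close>,
  reduced. \<open>relations\<close> describes the kernel on \<int> \<times> \<int>, so it gives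
  compatibility with reduction modulo \<open>A\<close> and \<open>B\<close> as well as injectivity;
  \<open>generate\<close> gives surjectivity.\<close>

lemma residues_of_iso_DirProd:
  assumes pos: "m > 0" "n > 0" "A > 0" "B > 0"
    and L: "int_submodule L" "(int m, 0) \<in> L" "(0, int n) \<in> L"
    and gens: "(s, s') \<in> L" "(t, t') \<in> L"
    and generate: "\<And>x y. (x, y) \<in> L \<Longrightarrow> \<exists>q p. x = q * s + p * t \<and> y = q * s' + p * t'"
    and relations: "\<And>q p. int m dvd q * s + p * t \<and> int n dvd q * s' + p * t' \<longleftrightarrow>
      int A dvd q \<and> int B dvd p"
  shows "(integer_mod_group m \<times>\<times> integer_mod_group n)\<lparr>carrier := residues_of m n L\<rparr> \<cong>
    integer_mod_group A \<times>\<times> integer_mod_group B"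
proof -
  let ?G = "integer_mod_group A \<times>\<times> integer_mod_group B"
  let ?K = "(integer_mod_group m \<times>\<times> integer_mod_group n)\<lparr>carrier := residues_of m n L\<rparr>"
  define h where "h = (\<lambda>(q, p). ((q * s + p * t) mod int m, (q * s' + p * t') mod int n))"
  have h_eq_iff: "h (q, p) = h (q', p') \<longleftrightarrow> [q = q'] (mod int A) \<and> [p = p'] (mod int B)" for q p q' p'
  proof -
    have "h (q, p) = h (q', p') \<longleftrightarrow>
        int m dvd (q - q') * s + (p - p') * t \<and> int n dvd (q - q') * s' + (p - p') * t'"
      by (simp add: h_def mod_eq_dvd_iff algebra_simps)
    thus ?thesis by (simp only: relations cong_iff_dvd_diff)
  qed
  have h_in: "h z \<in> residues_of m n L" for z
  proof -
    obtain q p where z: "z = (q, p)" by fastforce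
    have "(q * s + p * t, q * s' + p * t') \<in> L"
      using int_submodule_add int_submodule_scale L(1) gens by blast
    thus ?thesis
      using pos int_submodule_mod_iff[OF L] by (simp add: z h_def residues_of_def)
  qed
  have "h \<in> iso ?G ?K"
  proof (rule isoI)
    show "h \<in> hom ?G ?K"
    proof (rule homI)
      show "h z \<in> carrier ?K" for z using h_in by simp
      fix y z :: "int \<times> int"
      obtain q p q' p' where yz: "y = (q, p)" "z = (q', p')" by fastforce
      \<comment> \<open>The sum in \<open>?G\<close> is reduced modulo \<open>A\<close> and
        \<open>B\<close>, which \<open>h\<close> does not notice by \<open>h_eq_iff\<close>.\<close>
      have "h (y \<otimes>\<^bsub>?G\<^esub> z) = h (q + q', p + p')"
        by (simp add: yz h_eq_iff)
      also have "\<dots> = h y \<otimes>\<^bsub>?K\<^esub> h z"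
        by (simp add: yz h_def mod_add_eq algebra_simps)
      finally show "h (y \<otimes>\<^bsub>?G\<^esub> z) = h y \<otimes>\<^bsub>?K\<^esub> h z" .
    qed
    show "bij_betw h (carrier ?G) (carrier ?K)"
    proof (rule bij_betw_imageI)
      show "inj_on h (carrier ?G)"
      proof (rule inj_onI)
        fix y z assume yz: "y \<in> carrier ?G" "z \<in> carrier ?G" "h y = h z"
        obtain q p q' p' where eq: "y = (q, p)" "z = (q', p')" by fastforce
        from yz show "y = z"
          using pos unfolding eq h_eq_iff
          by (auto simp: carrier_integer_mod_group cong_def)
      qed
      show "h ` carrier ?G = carrier ?K"
      proof (intro equalityI subsetI)
        fix z assume "z \<in> h ` carrier ?G" thus "z \<in> carrier ?K" using h_in by auto
      next
        fix z assume "z \<in> carrier ?K"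
        then obtain x y where z: "z = (x, y)" "(x, y) \<in> L" "x mod int m = x" "y mod int n = y"
          by (auto simp: residues_of_def)
        obtain q p where "x = q * s + p * t" "y = q * s' + p * t'" using generate[OF z(2)] by blast
        hence "z = h (q, p)" using z by (simp add: h_def)
        also have "\<dots> = h (q mod int A, p mod int B)" by (simp add: h_eq_iff)
        also have "\<dots> \<in> h ` carrier ?G"
          using pos by (intro imageI) (simp add: carrier_integer_mod_group)
        finally show "z \<in> h ` carrier ?G" .
      qed
    qed
  qed
  moreover have "group ?G" by (simp add: DirProd_group)
  ultimately show ?thesis using group.iso_sym is_isoI by blast
qed

section \<open>Order and exponent as invariants\<close>

lemma nat_pow_DirProd:
  "(x, y) [^]\<^bsub>G \<times>\<times> H\<^esub> (k::nat) = (x [^]\<^bsub>G\<^esub> k, y [^]\<^bsub>H\<^esub> k)"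
  by (induction k) auto

lemma iso_pow_eq_one:
  assumes "group G" "group H" "G \<cong> H"
    and one: "\<And>x. x \<in> carrier G \<Longrightarrow> x [^]\<^bsub>G\<^esub> (k::nat) = \<one>\<^bsub>G\<^esub>" and y: "y \<in> carrier H"
  shows "y [^]\<^bsub>H\<^esub> k = \<one>\<^bsub>H\<^esub>"
proof -
  obtain h where h: "h \<in> hom G H" "h ` carrier G = carrier H"
    using assms(3) by (auto simp: is_iso_def iso_iff)
  obtain x where "x \<in> carrier G" "y = h x" using h y by auto
  thus ?thesis using hom_nat_pow[OF h(1)] assms(1,2) one hom_one[OF h(1)] by metis
qed

text \<open>Since \<open>A\<close> divides \<open>B\<close>, multiples of \<open>B\<close> kill both
  factors, while a generator of the second factor has order exactly \<open>B\<close>.\<close>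

lemma exponent_integer_mod_group_DirProd:
  assumes "A > 0" "B > 0" "A dvd B"
  shows "(\<forall>z \<in> carrier (integer_mod_group A \<times>\<times> integer_mod_group B).
           z [^]\<^bsub>integer_mod_group A \<times>\<times> integer_mod_group B\<^esub> k =
             \<one>\<^bsub>integer_mod_group A \<times>\<times> integer_mod_group B\<^esub>) \<longleftrightarrow> B dvd k"
proof
  assume *: "\<forall>z \<in> carrier (integer_mod_group A \<times>\<times> integer_mod_group B).
           z [^]\<^bsub>integer_mod_group A \<times>\<times> integer_mod_group B\<^esub> k =
             \<one>\<^bsub>integer_mod_group A \<times>\<times> integer_mod_group B\<^esub>"
  \<comment> \<open>The reduction matters for \<open>B = 1\<close>, where 1 is not in the
    carrier.\<close>
  have "(0, 1 mod int B) \<in> carrier (integer_mod_group A \<times>\<times> integer_mod_group B)"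
    using assms by (simp add: carrier_integer_mod_group)
  from bspec[OF * this] have "int k mod int B = 0"
    by (simp add: nat_pow_DirProd mod_mult_right_eq)
  thus "B dvd k" by (simp add: mod_eq_0_iff_dvd)
next
  assume "B dvd k"
  hence "int A dvd int k" "int B dvd int k" using assms by auto
  thus "\<forall>z \<in> carrier (integer_mod_group A \<times>\<times> integer_mod_group B).
           z [^]\<^bsub>integer_mod_group A \<times>\<times> integer_mod_group B\<^esub> k =
             \<one>\<^bsub>integer_mod_group A \<times>\<times> integer_mod_group B\<^esub>"
    by (auto simp: nat_pow_DirProd mod_eq_0_iff_dvd)
qed

lemma integer_mod_group_DirProd_iso_imp_eq:
  assumes "A > 0" "B > 0" "A dvd B" "C > 0" "D > 0" "C dvd D"
    and iso: "integer_mod_group A \<times>\<times> integer_mod_group B \<cong> integer_mod_group C \<times>\<times> integer_mod_group D"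
  shows "A = C" "B = D"
proof -
  let ?G = "integer_mod_group A \<times>\<times> integer_mod_group B"
  let ?H = "integer_mod_group C \<times>\<times> integer_mod_group D"
  have gr: "group ?G" "group ?H" by (simp_all add: DirProd_group)
  have iso': "?H \<cong> ?G" using group.iso_sym gr iso by blast
  \<comment> \<open>Isomorphic groups are killed by the same exponents, so \<open>B\<close> and
    \<open>D\<close> have the same multiples.\<close>
  have "B dvd k \<longleftrightarrow> D dvd k" for k
    unfolding exponent_integer_mod_group_DirProd[OF assms(1-3), symmetric]
      exponent_integer_mod_group_DirProd[OF assms(4-6), symmetric]
    using iso_pow_eq_one[OF gr iso, of k] iso_pow_eq_one[OF gr(2,1) iso', of k] by blast
  thus "B = D" using dvd_antisym dvd_refl by metis
  have "A * B = C * D"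
    using iso_same_card[OF iso] assms by (simp add: carrier_integer_mod_group card_cartesian_product)
  thus "A = C" using \<open>B = D\<close> assms by simp
qed

section \<open>Isomorphism type of a Goursat lattice\<close>

text \<open>Scaling the coordinates by \<open>a\<close> and \<open>b\<close> carries the generators
  \<open>(s, v * s + e)\<close> and \<open>(1, v)\<close> of the cyclic decomposition into the
  lattice. Replacing \<open>u\<close> by its lift \<open>v\<close> leaves the lattice
  unchanged.\<close>

lemma goursat_lattice_iso_DirProd:
  assumes pos: "a > 0" "b > 0" "i > 0" "j > 0" and Ae: "A * e = gcd i j" and u: "coprime u (int e)"
  shows "(integer_mod_group (a * i) \<times>\<times> integer_mod_group (b * j))
      \<lparr>carrier := residues_of (a * i) (b * j) (goursat_lattice (int a) (int b) (int e) u)\<rparr> \<cong>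
    integer_mod_group A \<times>\<times> integer_mod_group (lcm i j)"
proof -
  have ij: "int i > 0" "int j > 0" using pos by simp_all
  have "int A * int e = gcd (int i) (int j)"
    using Ae by (metis of_nat_mult gcd_int_int_eq)
  note decomposition = ex_cyclic_decomposition[OF ij this u]
  obtain s v where v: "[v = u] (mod int e)"
    and rel: "\<forall>q p. int i dvd p + q * s \<and> int j dvd v * (p + q * s) + q * int e \<longleftrightarrow>
      int A dvd q \<and> lcm (int i) (int j) dvd p"
    by (rule decomposition)
  have e: "e dvd i" "e dvd j"
    using Ae by (metis dvd_triv_right dvd_trans gcd_dvd1, metis dvd_triv_right dvd_trans gcd_dvd2)
  have "A > 0" using Ae pos by (cases "A = 0") auto
  let ?L = "goursat_lattice (int a) (int b) (int e) v"
  have iff: "(int a * x, int b * y) \<in> ?L \<longleftrightarrow> int e dvd y - v * x" for x y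
    using pos by (simp add: goursat_lattice_iff)
  have "(integer_mod_group (a * i) \<times>\<times> integer_mod_group (b * j))
      \<lparr>carrier := residues_of (a * i) (b * j) ?L\<rparr> \<cong>
    integer_mod_group A \<times>\<times> integer_mod_group (lcm i j)"
  proof (rule residues_of_iso_DirProd[where s = "int a * s" and s' = "int b * (v * s + int e)"
        and t = "int a" and t' = "int b * v"])
    show "int_submodule ?L" using pos by (simp add: int_submodule_goursat_lattice)
    show "(int (a * i), 0) \<in> ?L" "(0, int (b * j)) \<in> ?L"
      using iff[of "int i" 0] iff[of 0 "int j"] e by simp_all
    show "(int a * s, int b * (v * s + int e)) \<in> ?L" "(int a, int b * v) \<in> ?L"
      using iff[of s "v * s + int e"] iff[of 1 v] by simp_all
    show "\<exists>q p. x = q * (int a * s) + p * int a \<and>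
        y = q * (int b * (v * s + int e)) + p * (int b * v)" if xyL: "(x, y) \<in> ?L" for x y
    proof -
      obtain x' y' where xy: "(x, y) = (int a * x', int b * y')" and "int e dvd y' - v * x'"
        using xyL by (rule goursat_latticeE)
      then obtain k where "y' - v * x' = int e * k" by (elim dvdE)
      hence "y' = v * x' + int e * k" by simp
      \<comment> \<open>\<open>(x', y')\<close> equals
        \<open>k * (s, v * s + e) + (x' - k * s) * (1, v)\<close>.\<close>
      thus ?thesis using xy
        by (intro exI[of _ k] exI[of _ "x' - k * s"]) (simp add: algebra_simps)
    qed
    fix q p
    have "int (a * i) dvd q * (int a * s) + p * int a \<longleftrightarrow> int i dvd p + q * s"
    proof -
      have "q * (int a * s) + p * int a = int a * (p + q * s)" by (simp add: algebra_simps)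
      thus ?thesis using pos by simp
    qed
    moreover have "int (b * j) dvd q * (int b * (v * s + int e)) + p * (int b * v) \<longleftrightarrow>
        int j dvd v * (p + q * s) + q * int e"
    proof -
      have "q * (int b * (v * s + int e)) + p * (int b * v) =
          int b * (v * (p + q * s) + q * int e)" by (simp add: algebra_simps)
      thus ?thesis using pos by simp
    qed
    ultimately show "int (a * i) dvd q * (int a * s) + p * int a \<and>
        int (b * j) dvd q * (int b * (v * s + int e)) + p * (int b * v) \<longleftrightarrow>
        int A dvd q \<and> int (lcm i j) dvd p"
      using rel by (simp add: lcm_int_int_eq)
  qed (use pos \<open>A > 0\<close> in \<open>simp_all add: lcm_pos_nat\<close>)
  thus ?thesis using goursat_lattice_cong[OF v] by simp
qed

section \<open>Uniqueness of the parameters\<close>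

text \<open>The test vectors \<open>(a, b * u)\<close> and \<open>(a * v, b)\<close>, with
  \<open>v\<close> inverse to \<open>u\<close> modulo \<open>e\<close>, expose \<open>a\<close> and
  \<open>b\<close> as coordinates. Two opposite inclusions thus determine positive \<open>a\<close>
  and \<open>b\<close>.\<close>

lemma goursat_lattice_subset_imp_dvd:
  assumes "a \<noteq> 0" "b \<noteq> 0" "coprime u e" "goursat_lattice a b e u \<subseteq> goursat_lattice a' b' e' u'"
  shows "a' dvd a" "b' dvd b"
proof -
  have "(a * 1, b * u) \<in> goursat_lattice a b e u"
    unfolding goursat_lattice_iff[OF assms(1,2)] by simp
  with assms(4) have "(a * 1, b * u) \<in> goursat_lattice a' b' e' u'" by blast
  thus "a' dvd a" by (elim goursat_latticeE) auto
  obtain v where "[u * v = 1] (mod e)" using assms(3) cong_solve_coprime_int by blast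
  hence "(a * v, b * 1) \<in> goursat_lattice a b e u"
    unfolding goursat_lattice_iff[OF assms(1,2)]
    by (simp add: cong_iff_dvd_diff dvd_diff_commute)
  with assms(4) have "(a * v, b * 1) \<in> goursat_lattice a' b' e' u'" by blast
  thus "b' dvd b" by (elim goursat_latticeE) auto
qed

lemma residues_of_eq_imp_eq:
  assumes "m > 0" "n > 0"
    and L: "int_submodule L" "(int m, 0) \<in> L" "(0, int n) \<in> L"
    and K: "int_submodule K" "(int m, 0) \<in> K" "(0, int n) \<in> K"
    and eq: "residues_of m n L = residues_of m n K"
  shows "L = K"
proof -
  have "(x, y) \<in> L \<longleftrightarrow> (x, y) \<in> K" for x y
  proof -
    have "(x mod int m, y mod int n) \<in> residues_of m n L \<longleftrightarrow>
        (x mod int m, y mod int n) \<in> residues_of m n K" by (simp only: eq)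
    thus ?thesis
      using assms(1,2) int_submodule_mod_iff[OF L] int_submodule_mod_iff[OF K]
      by (simp add: residues_of_def)
  qed
  thus ?thesis by auto
qed

lemma ex_totative_cong:
  assumes "e > 0" "coprime u (int e)"
  obtains k where "k \<in> totatives e" "[int k = u] (mod int e)"
\<comment> \<open>Totatives are taken from 1 to \<open>e\<close>, so for \<open>e = 1\<close> the
  representative is 1 and not \<open>u mod 1 = 0\<close>.\<close>
proof (cases "e = 1")
  case True
  thus thesis using that[of 1] by (simp add: cong_def)
next
  case False
  define k where "k = nat (u mod int e)"
  have k: "int k = u mod int e" using assms by (simp add: k_def)
  have "coprime (int k) (int e)" using assms k by (simp add: coprime_mod_left_iff)
  hence "coprime k e" by simp
  moreover have "k > 0" using \<open>coprime k e\<close> False by (cases "k = 0") auto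
  moreover have "int k < int e" using assms k by simp
  ultimately have "k \<in> totatives e" by (simp add: in_totatives_iff)
  moreover have "[int k = u] (mod int e)" using k by (simp add: cong_def)
  ultimately show thesis by (rule that)
qed

text \<open>Cancel \<open>B\<close> in \<open>gcd i j * lcm i j = i * j\<close>. This identifies the
  argument of the totient with the parameter \<open>e\<close> of the normal form.\<close>

lemma gcd_eq_of_lcm_eq:
  fixes i j A B :: nat
  assumes "i > 0" "j > 0" "A * B dvd i * j" "lcm i j = B"
  shows "A * ((i * j) div (A * B)) = gcd i j" "(i * j) div (A * B) > 0"
proof -
  have "B > 0" using assms by (auto simp: lcm_pos_nat)
  obtain e where e: "i * j = A * B * e" using assms(3) by (elim dvdE)
  have "gcd i j * B = A * e * B" using prod_gcd_lcm_nat[of i j] assms(4) e by (auto simp: mult_ac)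
  hence "gcd i j = A * e" using \<open>B > 0\<close> by (metis mult_right_cancel less_not_refl)
  moreover have "A * B > 0" using e assms(1,2) by (metis gr0I mult_is_0)
  ultimately show "A * ((i * j) div (A * B)) = gcd i j" "(i * j) div (A * B) > 0"
    using e assms(1,2) by (auto intro!: Nat.gr0I)
qed

lemma cong_residue_eq_nat:
  fixes u v e :: nat
  assumes "[u = v] (mod e)" "0 < u" "u \<le> e" "0 < v" "v \<le> e"
  shows "u = v"
  using assms by (cases "u = e"; cases "v = e") (auto simp: cong_def)

section \<open>Counting the subgroups\<close>

lemma num_subgroups_iso_eq_sum_totient:
  fixes m n A B :: nat
  assumes pos: "m > 0" "n > 0" "A > 0" "B > 0" and "A dvd B"
  shows "num_subgroups_iso A B m n =
    (\<Sum>(i, j) \<in> {(i, j). 0 < i \<and> 0 < j \<and> i dvd m \<and> j dvd n \<and> A * B dvd i * j \<and> lcm i j = B}.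
       totient ((i * j) div (A * B)))"
proof -
  define S where "S = {(i, j). 0 < i \<and> 0 < j \<and> i dvd m \<and> j dvd n \<and> A * B dvd i * j \<and> lcm i j = B}"
  define E where "E = (\<lambda>(i, j). (i * j) div (A * B))"
  define \<Lambda> where "\<Lambda> = (\<lambda>(i, j) u. goursat_lattice (int (m div i)) (int (n div j)) (int (E (i, j))) (int u))"
  define F where "F = (\<lambda>p u. residues_of m n (\<Lambda> p u))"
  let ?G = "integer_mod_group m \<times>\<times> integer_mod_group n"
  let ?C = "integer_mod_group A \<times>\<times> integer_mod_group B"
  define \<H> where "\<H> = {H. subgroup H ?G \<and> ?G\<lparr>carrier := H\<rparr> \<cong> ?C}"
  have S_divs: "0 < i" "0 < j" "m = m div i * i" "n = n div j * j" "0 < m div i" "0 < n div j"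
    "A * E (i, j) = gcd i j" "0 < E (i, j)" "lcm i j = B" if "(i, j) \<in> S" for i j
    using that pos gcd_eq_of_lcm_eq[of i j A B]
    by (auto simp: S_def E_def dvd_imp_le div_greater_zero_iff)
  have \<Lambda>: "int_submodule (\<Lambda> (i, j) u)" "(int m, 0) \<in> \<Lambda> (i, j) u" "(0, int n) \<in> \<Lambda> (i, j) u"
    if ij: "(i, j) \<in> S" for i j u
  proof -
    note d = S_divs[OF ij]
    have nz: "int (m div i) \<noteq> 0" "int (n div j) \<noteq> 0" using d by simp_all
    have e: "E (i, j) dvd i" "E (i, j) dvd j"
      using d(7) by (metis dvd_triv_right dvd_trans gcd_dvd1, metis dvd_triv_right dvd_trans gcd_dvd2)
    show "int_submodule (\<Lambda> (i, j) u)"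
      using int_submodule_goursat_lattice[OF nz] by (simp add: \<Lambda>_def)
    have "(int (m div i) * int i, int (n div j) * 0) \<in> \<Lambda> (i, j) u"
      "(int (m div i) * 0, int (n div j) * int j) \<in> \<Lambda> (i, j) u"
      unfolding \<Lambda>_def prod.case goursat_lattice_iff[OF nz] using e by simp_all
    thus "(int m, 0) \<in> \<Lambda> (i, j) u" "(0, int n) \<in> \<Lambda> (i, j) u"
      using d(3,4) by (metis of_nat_mult mult_zero_right)+
  qed
  \<comment> \<open>This yields both the disjointness of the families for different pairs and the
    injectivity of each \<open>F p\<close> on totatives.\<close>
  have inj: "(i, j) = (i', j') \<and> u = u'"
    if ij: "(i, j) \<in> S" "(i', j') \<in> S" and u: "u \<in> totatives (E (i, j))" "u' \<in> totatives (E (i', j'))"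
      and eq: "F (i, j) u = F (i', j') u'" for i j i' j' u u'
  proof -
    note d = S_divs[OF ij(1)] and d' = S_divs[OF ij(2)]
    have cop: "coprime (int u) (int (E (i, j)))" "coprime (int u') (int (E (i', j')))"
      using u by (simp_all add: in_totatives_iff)
    have nz: "int (m div i) \<noteq> 0" "int (n div j) \<noteq> 0" "int (m div i') \<noteq> 0" "int (n div j') \<noteq> 0"
      using d d' by simp_all
    have eq\<Lambda>: "\<Lambda> (i, j) u = \<Lambda> (i', j') u'"
      using residues_of_eq_imp_eq[OF pos(1,2) \<Lambda>[OF ij(1)] \<Lambda>[OF ij(2)]] eq by (simp add: F_def)
    note goursat_lattice_subset_imp_dvd[OF nz(1,2) cop(1) equalityD1[OF eq\<Lambda>[unfolded \<Lambda>_def prod.case]]]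
      goursat_lattice_subset_imp_dvd[OF nz(3,4) cop(2) equalityD2[OF eq\<Lambda>[unfolded \<Lambda>_def prod.case]]]
    hence "m div i' dvd m div i" "n div j' dvd n div j" "m div i dvd m div i'" "n div j dvd n div j'"
      by (simp_all only: int_dvd_int_iff)
    hence "m div i = m div i'" "n div j = n div j'" by (simp_all add: dvd_antisym)
    hence ij_eq: "i = i'" "j = j'"
      using d d' by (metis mult_cancel_left less_not_refl)+
    \<comment> \<open>With the pairs matched, only the units are left to compare: this vector of the
      first lattice, tested in the second, gives the congruence of \<open>u\<close> and
      \<open>u'\<close>.\<close>
    have "(int (m div i) * 1, int (n div j) * int u) \<in> \<Lambda> (i, j) u"
      unfolding \<Lambda>_def prod.case goursat_lattice_iff[OF nz(1,2)] by simp
    hence "(int (m div i) * 1, int (n div j) * int u) \<in> \<Lambda> (i, j) u'"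
      using eq\<Lambda> ij_eq by simp
    hence "int (E (i, j)) dvd int u - int u'"
      unfolding \<Lambda>_def prod.case goursat_lattice_iff[OF nz(1,2)] by simp
    hence "[u = u'] (mod E (i, j))"
      by (simp add: cong_iff_dvd_diff flip: cong_int_iff)
    moreover have "0 < u" "u \<le> E (i, j)" "0 < u'" "u' \<le> E (i, j)"
      using u ij_eq by (simp_all add: in_totatives_iff)
    ultimately have "u = u'" by (rule cong_residue_eq_nat)
    thus ?thesis using ij_eq by simp
  qed
  have H_eq: "\<H> = (\<Union>p \<in> S. F p ` totatives (E p))"
  proof (intro equalityI subsetI)
    fix H assume "H \<in> \<H>"
    hence H: "subgroup H ?G" "?G\<lparr>carrier := H\<rparr> \<cong> ?C" by (simp_all add: \<H>_def)
    obtain L where L: "int_submodule L" "(int m, 0) \<in> L" "(0, int n) \<in> L" "H = residues_of m n L"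
      using subgroup_eq_residues_of[OF pos(1,2) H(1)] .
    obtain a b e u where *: "a > 0" "b > 0" "e > 0" "coprime u e" "a * e dvd int m" "b * e dvd int n"
      "L = goursat_lattice a b e u"
      by (rule int_submodule_eq_goursat_lattice[OF L(1,2) _ L(3)]) (use pos in auto)
    define a' b' e' where "a' = nat a" "b' = nat b" "e' = nat e"
    have abe: "a = int a'" "b = int b'" "e = int e'" "a' > 0" "b' > 0" "e' > 0"
      using * by (simp_all add: a'_b'_e'_def)
    have "a' * e' dvd m" "b' * e' dvd n"
      using *(5,6) unfolding abe of_nat_mult[symmetric] by (simp_all only: int_dvd_int_iff)
    then obtain k l where kl: "m = a' * e' * k" "n = b' * e' * l" by (elim dvdE)
    \<comment> \<open>These are \<open>m / a'\<close> and \<open>n / b'\<close>, the orders of the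
      two projections of \<open>H\<close>.\<close>
    define i j where "i = e' * k" "j = e' * l"
    have mn: "m = a' * i" "n = b' * j" and ij: "i > 0" "j > 0"
      using kl pos by (auto simp: i_j_def)
    obtain C where C: "C * e' = gcd i j"
      unfolding i_j_def by (metis gcd_mult_distrib_nat mult.commute)
    hence "C > 0" using ij by (cases "C = 0") auto
    have "C dvd lcm i j" using C by (metis dvd_triv_left dvd_trans gcd_dvd1 dvd_lcm1)
    have "?G\<lparr>carrier := H\<rparr> \<cong> integer_mod_group C \<times>\<times> integer_mod_group (lcm i j)"
      using goursat_lattice_iso_DirProd[OF abe(4,5) ij C, of u] *(4) L(4) *(7) abe mn by simp
    moreover have "?C \<cong> ?G\<lparr>carrier := H\<rparr>"
      using group.iso_sym[OF subgroup.subgroup_is_group[OF H(1)]] H(2) by (simp add: DirProd_group)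
    ultimately have "?C \<cong> integer_mod_group C \<times>\<times> integer_mod_group (lcm i j)"
      using iso_trans by blast
    \<comment> \<open>The type computed from the normal form must agree with the prescribed one,
      which forces \<open>(i, j)\<close> into \<open>S\<close> and
      \<open>e' = E (i, j)\<close>.\<close>
    from integer_mod_group_DirProd_iso_imp_eq[OF pos(3,4) assms(5) \<open>C > 0\<close> _ \<open>C dvd lcm i j\<close> this]
    have CB: "A = C" "B = lcm i j" using ij by (simp_all add: lcm_pos_nat)
    have "i * j = (C * e') * lcm i j" unfolding C by (rule prod_gcd_lcm_nat)
    hence prod: "i * j = A * B * e'" using CB by (simp add: mult_ac)
    have "(i, j) \<in> S" using ij mn prod CB by (simp add: S_def)
    moreover have "E (i, j) = e'" using prod pos by (simp add: E_def)
    moreover obtain t where t: "t \<in> totatives e'" "[int t = u] (mod int e')"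
      using ex_totative_cong abe(3,6) *(4) by metis
    moreover have "F (i, j) t = H"
      using goursat_lattice_cong[OF t(2)] abe(1-3) *(7) L(4) mn ij \<open>E (i, j) = e'\<close>
      by (simp add: F_def \<Lambda>_def)
    ultimately show "H \<in> (\<Union>p \<in> S. F p ` totatives (E p))" by blast
  next
    fix H assume "H \<in> (\<Union>p \<in> S. F p ` totatives (E p))"
    then obtain i j u where ij: "(i, j) \<in> S" and u: "u \<in> totatives (E (i, j))" and H: "H = F (i, j) u"
      by auto
    note d = S_divs[OF ij]
    have "subgroup H ?G"
      unfolding H F_def using subgroup_residues_of[OF pos(1,2) \<Lambda>[OF ij]] .
    moreover have "?G\<lparr>carrier := H\<rparr> \<cong> ?C"
      using goursat_lattice_iso_DirProd[OF d(5,6,1,2,7), of "int u"] u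
      by (simp add: H F_def \<Lambda>_def d(3,4)[symmetric] d(9) in_totatives_iff)
    ultimately show "H \<in> \<H>" by (simp add: \<H>_def)
  qed
  have "S \<subseteq> {..m} \<times> {..n}" using pos by (auto simp: S_def dvd_imp_le)
  hence "finite S" by (rule finite_subset) simp
  have "num_subgroups_iso A B m n = card (\<Union>p \<in> S. F p ` totatives (E p))"
    using H_eq by (simp add: num_subgroups_iso_def \<H>_def)
  also have "\<dots> = (\<Sum>p \<in> S. card (F p ` totatives (E p)))"
    using \<open>finite S\<close> inj by (intro card_UN_disjoint) fastforce+
  also have "\<dots> = (\<Sum>p \<in> S. totient (E p))"
  proof (intro sum.cong refl)
    fix p assume "p \<in> S"
    hence "inj_on (F p) (totatives (E p))" using inj by (cases p) (auto intro!: inj_onI)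
    thus "card (F p ` totatives (E p)) = totient (E p)" by (simp add: card_image totient_def)
  qed
  finally show ?thesis by (simp add: S_def E_def case_prod_beta)
qed

theorem theorem4p5:
  fixes m n A B :: nat
  assumes "0 < m" and "0 < n" and "0 < A" and "0 < B"
    and "A dvd B" and "A * B dvd m * n"
  shows "(A dvd gcd m n \<longrightarrow>
            num_subgroups_iso A B m n =
              (\<Sum>(i, j) \<in> {(i, j). 0 < i \<and> 0 < j \<and> i dvd m \<and> j dvd n \<and>
                                   A * B dvd i * j \<and> lcm i j = B}.
                 totient ((i * j) div (A * B)))) \<and>
         (\<not> A dvd gcd m n \<longrightarrow> num_subgroups_iso A B m n = 0)"
proof (intro conjI impI)
  note count = num_subgroups_iso_eq_sum_totient[OF assms(1-5)]
  show "num_subgroups_iso A B m n =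
              (\<Sum>(i, j) \<in> {(i, j). 0 < i \<and> 0 < j \<and> i dvd m \<and> j dvd n \<and>
                                   A * B dvd i * j \<and> lcm i j = B}.
                 totient ((i * j) div (A * B)))"
    by (rule count)
  assume ndvd: "\<not> A dvd gcd m n"
  \<comment> \<open>Any index pair would make \<open>A\<close> divide \<open>gcd i j\<close>, hence
    \<open>gcd m n\<close>; so the sum is empty.\<close>
  have "A dvd gcd m n" if "0 < i" "0 < j" "i dvd m" "j dvd n" "A * B dvd i * j" "lcm i j = B" for i j
  proof -
    have "A dvd gcd i j" using gcd_eq_of_lcm_eq(1)[OF that(1,2,5,6)] by (metis dvd_triv_left)
    also have "gcd i j dvd gcd m n" using that by (meson dvd_trans gcd_dvd1 gcd_dvd2 gcd_greatest)
    finally show ?thesis .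
  qed
  with ndvd have empty: "{(i, j). 0 < i \<and> 0 < j \<and> i dvd m \<and> j dvd n \<and> A * B dvd i * j \<and> lcm i j = B} = {}"
    by blast
  show "num_subgroups_iso A B m n = 0" unfolding count empty by simp
qed

end
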